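(* Let $\alpha := 2^{-5/2}\, 3^{1/2}\, \pi$. Let $k\ge 1$ and $n\ge 2k$ be integers, and let $f\in C(T_n^\perp)$. Then $$ \|f\| \le \frac{k+1}{\binom{2k}{k}}\ \omega_{2k}\Bigl(f,\frac{2\pi}{n}\,\alpha\Bigr). $$
   Context: $T=[-\pi,\pi)$ is the circle $\mathbb{R}/2\pi\mathbb{Z}$, and $C(T)$ is the space of continuous (complex-valued, $2\pi$-periodic) functions on $T$ with norm $\|f\|:=\max_{x\in T}|f(x)|$. $C(T_n^\perp)$ denotes the class of functions $f\in C(T)$ that have no spectrum in $[-n,n]$, i.e. whose Fourier coefficients satisfy $\int_{-\pi}^{\pi}f(t)e^{-ijt}\,dt=0$ for all integers $j$ with $|j|\le n$. For an integer $m\ge1$ and a real step $h$, the (central) $m$-th difference is $$\Delta_h^m f(x):=\sum_{i=0}^m(-1)^{m-i}\binom{m}{i} f\bigl(x-(m/2)h+ih\bigr),$$ and the $m$-th modulus of smoothness is $\omega_m(f,\delta):=\sup_{x\in T,\ |h|<\delta}|\Delta_h^m f(x)|$ for $\delta>0$. *)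

theory Defs
  imports "HOL-Analysis.Analysis"
begin

text \<open>Functions on the circle are represented by their \<open>2\<pi>\<close>-periodic lifts to the real line.\<close>

definition C_T :: "(real \<Rightarrow> complex) set" where
  "C_T = {f. continuous_on UNIV f \<and> (\<forall>x. f (x + 2 * pi) = f x)}"

definition norm_T :: "(real \<Rightarrow> complex) \<Rightarrow> real" where
  "norm_T f = (SUP x\<in>{-pi..<pi}. norm (f x))"

definition C_T_perp :: "nat \<Rightarrow> (real \<Rightarrow> complex) set" where
  "C_T_perp n = {f \<in> C_T. \<forall>j::int. \<bar>j\<bar> \<le> int n \<longrightarrow>
     integral {-pi..pi} (\<lambda>t. f t * exp (- (\<i> * of_int j * complex_of_real t))) = 0}"

definition central_diff :: "nat \<Rightarrow> real \<Rightarrow> (real \<Rightarrow> complex) \<Rightarrow> real \<Rightarrow> complex" where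
  "central_diff m h f x =
     (\<Sum>i=0..m. (-1) ^ (m - i) * of_nat (m choose i) * f (x - (real m / 2) * h + real i * h))"

definition modulus_smoothness :: "nat \<Rightarrow> (real \<Rightarrow> complex) \<Rightarrow> real \<Rightarrow> real" where
  "modulus_smoothness m f \<delta> =
     (SUP (x, h)\<in>{-pi..<pi} \<times> {h. \<bar>h\<bar> < \<delta>}. norm (central_diff m h f x))"

text \<open>The suprema above are taken in the reals, so they are meaningful only for nonempty sets that
  are bounded above. The next lemmas confirm this on \<open>C_T\<close>; in particular \<open>norm_T\<close> is a maximum.\<close>

lemma C_T_shift:
  assumes "f \<in> C_T"
  shows "f (x + of_int j * (2 * pi)) = f x"
proof (induction j rule: int_induct[where k = 0])
  case base
  then show ?case by simp
next
  case (step1 i)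
  have "f ((x + of_int i * (2 * pi)) + 2 * pi) = f (x + of_int i * (2 * pi))"
    using assms unfolding C_T_def by blast
  with step1 show ?case by (simp add: algebra_simps)
next
  case (step2 i)
  have "f ((x + of_int (i - 1) * (2 * pi)) + 2 * pi) = f (x + of_int (i - 1) * (2 * pi))"
    using assms unfolding C_T_def by blast
  with step2 show ?case by (simp add: algebra_simps)
qed

lemma C_T_reduce:
  assumes "f \<in> C_T"
  obtains y where "y \<in> {-pi..<pi}" "f y = f x"
proof -
  define j where "j = \<lfloor>(x + pi) / (2 * pi)\<rfloor>"
  have "of_int j \<le> (x + pi) / (2 * pi)" "(x + pi) / (2 * pi) < of_int j + 1"
    unfolding j_def by linarith+
  then have "x + of_int (- j) * (2 * pi) \<in> {-pi..<pi}"
    by (simp add: field_simps)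
  with C_T_shift[OF assms] that show thesis by blast
qed

lemma norm_T_attained:
  assumes "f \<in> C_T"
  shows "\<exists>x\<in>{-pi..<pi}. norm_T f = norm (f x) \<and> (\<forall>y. norm (f y) \<le> norm (f x))"
proof -
  have "continuous_on {-pi..pi} (\<lambda>x. norm (f x))"
    using assms unfolding C_T_def by (auto intro: continuous_on_subset continuous_on_norm)
  then obtain z where z: "\<And>y. y \<in> {-pi..pi} \<Longrightarrow> norm (f y) \<le> norm (f z)"
    using continuous_attains_sup[of "{-pi..pi}" "\<lambda>x. norm (f x)"]
    by (metis atLeastatMost_empty_iff2 compact_Icc order_trans pi_ge_zero neg_le_0_iff_le)
  obtain x where x: "x \<in> {-pi..<pi}" "f x = f z"
    using C_T_reduce[OF assms] .
  have le: "norm (f y) \<le> norm (f x)" for y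
  proof -
    obtain y' where "y' \<in> {-pi..<pi}" "f y' = f y"
      using C_T_reduce[OF assms] .
    with z[of y'] x show ?thesis by simp
  qed
  have "norm_T f = norm (f x)"
    unfolding norm_T_def using x(1) le by (intro cSup_eq_maximum) blast+
  with x le show ?thesis by blast
qed

lemma modulus_smoothness_bdd_above:
  assumes "f \<in> C_T"
  shows "bdd_above ((\<lambda>(x, h). norm (central_diff m h f x)) ` ({-pi..<pi} \<times> {h. \<bar>h\<bar> < \<delta>}))"
proof -
  obtain M where M: "\<And>y. norm (f y) \<le> M"
    using norm_T_attained[OF assms] by blast
  have "norm (central_diff m h f x) \<le> (\<Sum>i=0..m. real (m choose i) * M)" for x h
    unfolding central_diff_def
    by (intro sum_norm_le) (auto simp: norm_mult norm_power intro!: mult_left_mono M)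
  then show ?thesis by (auto intro!: bdd_aboveI2)
qed

end

theory Submission
  imports Defs
begin

text \<open>Write \<open>C = binom(2k, k)\<close> and let \<open>f\<close> have no spectrum in \<open>[-n, n]\<close>. By density one may take \<open>f\<close> to be a
  trigonometric polynomial with frequencies \<open>\<bar>j\<bar> > n\<close>. Averaging the \<open>2k\<close>-th difference of step \<open>t\<close> over
  \<open>\<bar>t\<bar> < h\<close> with the hat weight \<open>(h - \<bar>t\<bar>) / h\<^sup>2\<close> gives \<open>\<plusminus>C f\<close> plus an error term, which is the Fourier
  multiplier with symbol \<open>h\<^bsup>-2\<^esup> j\<^bsup>-2\<^esup> (\<Sum>i\<noteq>k. (-1)\<^sup>i binom(2k, i) 2 (1 - cos (j(i-k)h)) / (i-k)\<^sup>2)\<close>.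
  On frequencies \<open>\<bar>j\<bar> \<ge> n\<close> the factor \<open>j\<^bsup>-2\<^esup>\<close> extends to an even sequence that is convex on the
  nonnegative integers and takes the value \<open>3/n\<^sup>2\<close> at \<open>0\<close>, hence is a nonnegative combination of Fejer
  multipliers and has norm at most \<open>3/n\<^sup>2\<close>. The trigonometric sum has norm at most
  \<open>10 binom(2k, k+1)\<close>. For \<open>n h = 2\<pi>\<alpha>\<close> we have \<open>(n h)\<^sup>2 = 3\<pi>\<^sup>4/8 \<ge> 30\<close>, so the error is at most
  \<open>binom(2k, k+1) \<parallel>f\<parallel> = C k/(k+1) \<parallel>f\<parallel>\<close>, which leaves \<open>C \<parallel>f\<parallel> / (k+1)\<close> bounded by the modulus.\<close>

section \<open>Density of trigonometric polynomials\<close>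

text \<open>The frequency set is kept apart from the coefficients so that a Fourier multiplier can
  rescale \<open>c\<close> while the spectrum \<open>J\<close> stays fixed.\<close>

definition trig_poly :: "int set \<Rightarrow> (int \<Rightarrow> complex) \<Rightarrow> real \<Rightarrow> complex" where
  "trig_poly J c x = (\<Sum>j\<in>J. c j * cis (of_int j * x))"

lemma has_integral_cis_int:
  "((\<lambda>t. cis (of_int j * t)) has_integral (if j = 0 then 2 * of_real pi else 0)) {-pi..pi}"
proof (cases "j = 0")
  case True
  then show ?thesis
    using has_integral_const_real[of "1::complex" "-pi" pi] by (simp add: scaleR_conv_of_real)
next
  case False
  define F where "F t = cis (of_int j * t) / (\<i> * of_int j)" for t :: real
  have "(F has_vector_derivative cis (of_int j * t)) (at t within {-pi..pi})" for t
  proof -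
    have "((\<lambda>z. exp (\<i> * of_int j * z) / (\<i> * of_int j)) has_field_derivative
        exp (\<i> * of_int j * of_real t)) (at (of_real t))"
      using False by (auto intro!: derivative_eq_intros)
    from has_vector_derivative_real_field[OF this] show ?thesis
      by (simp add: F_def[abs_def] cis_conv_exp mult_ac)
  qed
  then have "((\<lambda>t. cis (of_int j * t)) has_integral (F pi - F (-pi))) {-pi..pi}"
    by (intro fundamental_theorem_of_calculus) auto
  moreover have "F pi = F (-pi)"
    by (simp add: F_def cis.ctr complex_eq_iff sin_npi_int mult.commute)
  ultimately show ?thesis using False by simp
qed

lemma trig_poly_mono: "finite J \<Longrightarrow> J' \<subseteq> J \<Longrightarrow> trig_poly J' c = trig_poly J (\<lambda>j. if j \<in> J' then c j else 0)"
  unfolding trig_poly_def by (rule ext, rule sum.mono_neutral_cong_left) auto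

definition is_trig_poly :: "(real \<Rightarrow> complex) \<Rightarrow> bool" where
  "is_trig_poly p \<longleftrightarrow> (\<exists>J c. finite J \<and> p = trig_poly J c)"

lemma is_trig_poly_monomial: "is_trig_poly (\<lambda>x. a * cis (of_int j * x))"
  unfolding is_trig_poly_def trig_poly_def
  by (rule exI[of _ "{j}"], rule exI[of _ "\<lambda>_. a"]) auto

lemma is_trig_poly_const: "is_trig_poly (\<lambda>x. a)"
  using is_trig_poly_monomial[of a 0] by simp

lemma is_trig_poly_add:
  assumes "is_trig_poly p" "is_trig_poly q"
  shows "is_trig_poly (\<lambda>x. p x + q x)"
proof -
  obtain J c K d where J: "finite J" "p = trig_poly J c" and K: "finite K" "q = trig_poly K d"
    using assms unfolding is_trig_poly_def by blast
  have "p = trig_poly (J \<union> K) (\<lambda>j. if j \<in> J then c j else 0)"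
    "q = trig_poly (J \<union> K) (\<lambda>j. if j \<in> K then d j else 0)"
    using J K by (auto intro: trig_poly_mono)
  then have "(\<lambda>x. p x + q x) =
      trig_poly (J \<union> K) (\<lambda>j. (if j \<in> J then c j else 0) + (if j \<in> K then d j else 0))"
    by (auto simp: trig_poly_def sum.distrib ring_distribs)
  then show ?thesis unfolding is_trig_poly_def using J K by blast
qed

lemma is_trig_poly_sum:
  assumes "\<And>i. i \<in> I \<Longrightarrow> is_trig_poly (p i)"
  shows "is_trig_poly (\<lambda>x. \<Sum>i\<in>I. p i x)"
  using assms
  by (induction I rule: infinite_finite_induct) (auto intro: is_trig_poly_const is_trig_poly_add)

lemma is_trig_poly_mult:
  assumes "is_trig_poly p" "is_trig_poly q"
  shows "is_trig_poly (\<lambda>x. p x * q x)"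
proof -
  obtain J c K d where J: "p = trig_poly J c" and K: "q = trig_poly K d"
    using assms unfolding is_trig_poly_def by blast
  have "(\<lambda>x. p x * q x) = (\<lambda>x. \<Sum>i\<in>J. \<Sum>j\<in>K. (c i * d j) * cis (of_int (i + j) * x))"
    unfolding J K trig_poly_def sum_product
    by (simp add: ring_distribs mult_ac flip: cis_mult)
  then show ?thesis by (simp only:) (intro is_trig_poly_sum is_trig_poly_monomial)
qed

lemma is_trig_poly_cos: "is_trig_poly (\<lambda>x. of_real (cos x))"
proof -
  have "(\<lambda>x. complex_of_real (cos x)) =
      (\<lambda>x. (1/2) * cis (of_int 1 * x) + (1/2) * cis (of_int (-1) * x))"
    by (auto simp: complex_eq_iff)
  then show ?thesis by (simp only:) (intro is_trig_poly_add is_trig_poly_monomial)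
qed

lemma is_trig_poly_sin: "is_trig_poly (\<lambda>x. of_real (sin x))"
proof -
  have "(\<lambda>x. complex_of_real (sin x)) =
      (\<lambda>x. (-\<i>/2) * cis (of_int 1 * x) + (\<i>/2) * cis (of_int (-1) * x))"
    by (auto simp: complex_eq_iff)
  then show ?thesis by (simp only:) (intro is_trig_poly_add is_trig_poly_monomial)
qed

text \<open>On the unit circle a real-linear functional is a combination of cosine and sine, being
  determined by its values at \<open>1\<close> and \<open>\<i>\<close>; the remaining cases of the
  induction are the ring operations.\<close>

lemma is_trig_poly_polynomial_cis:
  fixes P :: "complex \<Rightarrow> real"
  assumes "real_polynomial_function P"
  shows "is_trig_poly (\<lambda>x. of_real (P (cis x)))"
  using assms
proof induction
  case (linear L)
  have "L (cis x) = L 1 * cos x + L \<i> * sin x" for x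
  proof -
    have "cis x = cos x *\<^sub>R 1 + sin x *\<^sub>R \<i>"
      by (auto simp: complex_eq_iff)
    then show ?thesis
      using linear by (simp add: bounded_linear.linear linear_add linear_scale)
  qed
  then show ?case
    by (auto intro!: is_trig_poly_add is_trig_poly_mult is_trig_poly_const is_trig_poly_cos is_trig_poly_sin)
qed (auto intro: is_trig_poly_const is_trig_poly_add is_trig_poly_mult)

text \<open>This makes \<open>f\<close> a function of the point \<open>cis x\<close> of the unit
  circle, which is where Stone-Weierstrass applies.\<close>

lemma C_T_cis_cong:
  assumes "f \<in> C_T" "cis a = cis b"
  shows "f a = f b"
proof -
  have "sin a = sin b \<and> cos a = cos b"
    using assms(2) by (auto simp: complex_eq_iff)
  then obtain n :: int where "a = b + 2 * pi * of_int n"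
    unfolding sin_cos_eq_iff by blast
  then show ?thesis using C_T_shift[OF assms(1), of b n] by (simp add: mult_ac)
qed

text \<open>\<open>Arg\<close> jumps across the negative real axis, but \<open>Arg2pi\<close> is
  continuous there, and periodicity gives \<open>f (Arg w) = f (Arg2pi w)\<close> for all nonzero
  \<open>w\<close>.\<close>

lemma continuous_on_C_T_Arg:
  assumes "f \<in> C_T"
  shows "continuous_on (- {0}) (\<lambda>z. f (Arg z))"
proof -
  have cont: "isCont f x" for x
    using assms by (simp add: C_T_def continuous_on_eq_continuous_at)
  have "isCont (\<lambda>z. f (Arg z)) z" if "z \<noteq> 0" for z
  proof (cases "z \<in> \<real>\<^sub>\<le>\<^sub>0")
    case False
    then show ?thesis by (intro isCont_o2[OF continuous_at_Arg] cont)
  next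
    case True
    then have "z \<notin> \<real>\<^sub>\<ge>\<^sub>0" using that by (auto simp: complex_nonpos_Reals_iff complex_nonneg_Reals_iff complex_eq_iff)
    then have "isCont (\<lambda>z. f (Arg2pi z)) z"
      by (intro isCont_o2[OF continuous_at_Arg2pi] cont)
    moreover have "\<forall>\<^sub>F w in nhds z. f (Arg w) = f (Arg2pi w)"
    proof -
      have "f (Arg w) = f (Arg2pi w)" if "w \<noteq> 0" for w
      proof (rule C_T_cis_cong[OF assms])
        have "cis (Arg2pi w) * of_real (norm w) = w"
          using Arg2pi_eq[of w] by (simp add: cis_conv_exp mult.commute)
        then have "cis (Arg2pi w) = sgn w"
          using that by (simp add: sgn_eq eq_divide_eq)
        with that show "cis (Arg w) = cis (Arg2pi w)" by (simp add: cis_Arg)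
      qed
      then show ?thesis using that t1_space_nhds[of z 0] by (auto elim: eventually_mono)
    qed
    ultimately show ?thesis by (simp add: isCont_cong)
  qed
  then show ?thesis by (auto intro!: continuous_at_imp_continuous_on)
qed

text \<open>Stone-Weierstrass on the unit circle approximates \<open>f (Arg z)\<close> by a
  polynomial in the real and imaginary parts of \<open>z\<close>; substituting
  \<open>z = cis x\<close> turns it into a trigonometric polynomial.\<close>

lemma trig_poly_dense:
  assumes "f \<in> C_T" "e > 0"
  obtains J c where "finite J" "\<And>x. norm (f x - trig_poly J c x) < e"
proof -
  have "continuous_on (sphere 0 1) (\<lambda>z. f (Arg z))"
    by (rule continuous_on_subset[OF continuous_on_C_T_Arg[OF assms(1)]]) auto
  then obtain P :: "complex \<Rightarrow> complex" where P: "polynomial_function P"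
    and le: "\<And>z. z \<in> sphere 0 1 \<Longrightarrow> norm (f (Arg z) - P z) < e"
    using Stone_Weierstrass_polynomial_function[of "sphere 0 1" "\<lambda>z. f (Arg z)" e] assms(2) by auto
  have eq: "f (Arg (cis x)) = f x" for x
    by (rule C_T_cis_cong[OF assms(1)]) (simp add: cis_Arg sgn_eq)
  have "real_polynomial_function (Re \<circ> P)" "real_polynomial_function (Im \<circ> P)"
    using P bounded_linear_Re bounded_linear_Im unfolding polynomial_function_def by auto
  then have "is_trig_poly (\<lambda>x. of_real (Re (P (cis x))) + \<i> * of_real (Im (P (cis x))))"
    by (auto simp: o_def dest!: is_trig_poly_polynomial_cis intro!: is_trig_poly_add is_trig_poly_mult is_trig_poly_const)
  then have "is_trig_poly (\<lambda>x. P (cis x))"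
    by (simp flip: complex_eq)
  then obtain J c where Jc: "finite J" "(\<lambda>x. P (cis x)) = trig_poly J c"
    unfolding is_trig_poly_def by blast
  have "norm (f x - trig_poly J c x) < e" for x
    using le[of "cis x"] fun_cong[OF Jc(2), of x] by (simp add: eq)
  with Jc(1) show thesis by (rule that)
qed

section \<open>Fourier coefficients and removal of low frequencies\<close>

lemma continuous_on_trig_poly: "continuous_on S (trig_poly J c)"
  unfolding trig_poly_def by (intro continuous_intros)

lemma trig_poly_coeff:
  assumes "finite J" "l \<in> J"
  shows "((\<lambda>t. trig_poly J c t * exp (- (\<i> * of_int l * complex_of_real t)))
    has_integral (2 * of_real pi * c l)) {-pi..pi}"
proof -
  have "((\<lambda>t. \<Sum>j\<in>J. c j * cis (of_int (j - l) * t)) has_integral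
      (\<Sum>j\<in>J. c j * (if j - l = 0 then 2 * of_real pi else 0))) {-pi..pi}"
    by (intro has_integral_sum has_integral_mult_right has_integral_cis_int assms(1))
  also have "(\<Sum>j\<in>J. c j * (if j - l = 0 then 2 * of_real pi else 0)) = 2 * of_real pi * c l"
    using assms by (simp add: if_distrib sum.delta cong: if_cong)
  also have "(\<lambda>t. \<Sum>j\<in>J. c j * cis (of_int (j - l) * t)) =
      (\<lambda>t. trig_poly J c t * exp (- (\<i> * of_int l * complex_of_real t)))"
    unfolding trig_poly_def sum_distrib_right cis_conv_exp mult.assoc exp_add[symmetric]
    by (simp add: algebra_simps)
  finally show ?thesis .
qed

text \<open>The low-frequency coefficients of a good approximation are themselves small, since they are
  Fourier coefficients of the error; so they can be dropped.\<close>

lemma C_T_perp_approx: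
  assumes "f \<in> C_T_perp n" "e > 0"
  obtains J c where "finite J" "\<And>j. j \<in> J \<Longrightarrow> \<bar>j\<bar> > int n"
    "\<And>x. norm (f x - trig_poly J c x) < e"
proof -
  \<comment> \<open>One share of size \<open>d\<close> pays for the approximation and at most
    \<open>2 * n + 1\<close> shares pay for the dropped coefficients.\<close>
  define d where "d = e / (2 * n + 2)"
  have d: "d > 0" using assms(2) by (simp add: d_def)
  have f: "f \<in> C_T" using assms(1) by (simp add: C_T_perp_def)
  obtain J c where J: "finite J" and le: "\<And>x. norm (f x - trig_poly J c x) < d"
    using trig_poly_dense[OF f d] by blast
  define L where "L = {j\<in>J. \<bar>j\<bar> \<le> int n}"
  have cont: "continuous_on {-pi..pi} f"
    using f continuous_on_subset unfolding C_T_def by blast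
  have small: "norm (c l) \<le> d" if "l \<in> L" for l
  proof -
    let ?E = "\<lambda>t. exp (- (\<i> * of_int l * complex_of_real t))"
    have "(\<lambda>t. f t * ?E t) integrable_on {-pi..pi}"
      by (intro integrable_continuous_real continuous_intros cont)
    moreover have "integral {-pi..pi} (\<lambda>t. f t * ?E t) = 0"
      using assms(1) that by (simp add: C_T_perp_def L_def)
    ultimately have "((\<lambda>t. f t * ?E t) has_integral 0) {-pi..pi}"
      by (simp add: has_integral_iff)
    \<comment> \<open>The coefficient of \<open>f\<close> at \<open>l\<close> vanishes, so that of
      the error is \<open>- c l\<close>; its size is bounded by the sup norm of the error.\<close>
    from has_integral_diff[OF this trig_poly_coeff[OF J, of l c]] that
    have "((\<lambda>t. (f t - trig_poly J c t) * ?E t) has_integral (- (2 * of_real pi * c l))) {-pi..pi}"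
      by (simp add: L_def algebra_simps)
    from has_integral_bound[OF _ this[unfolded box_real(2)[symmetric]], of d] d le
    have "norm (2 * of_real pi * c l) \<le> d * (2 * pi)"
      by (auto simp: norm_mult intro: less_imp_le)
    then show ?thesis by (simp add: norm_mult)
  qed
  have "norm (f x - trig_poly (J - L) c x) < e" for x
  proof -
    have split: "trig_poly J c x = trig_poly (J - L) c x + trig_poly L c x"
      unfolding trig_poly_def by (rule sum.subset_diff) (use J in \<open>auto simp: L_def\<close>)
    have "norm (trig_poly L c x) \<le> (\<Sum>j\<in>L. d)"
      unfolding trig_poly_def by (rule sum_norm_le) (simp add: norm_mult small)
    also have "\<dots> \<le> (2 * n + 1) * d"
    proof -
      have "card L \<le> card {-int n..int n}"
        by (rule card_mono) (auto simp: L_def)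
      also have "\<dots> = 2 * n + 1" by simp
      finally show ?thesis using d by (simp add: mult_right_mono del: of_nat_add of_nat_mult)
    qed
    finally have "norm (f x - trig_poly (J - L) c x) < d + (2 * n + 1) * d"
      using le[of x] norm_triangle_ineq[of "f x - trig_poly J c x" "trig_poly L c x"]
      by (simp add: split)
    also have "\<dots> = d * (2 * n + 2)" by (simp add: algebra_simps)
    also have "\<dots> = e" by (simp add: d_def del: of_nat_add of_nat_mult)
    finally show ?thesis .
  qed
  with J show thesis by (intro that[of "J - L" c]) (auto simp: L_def)
qed

section \<open>Norms of Fourier multipliers\<close>

text \<open>A bound \<open>B\<close> for the operator norm, in the sup norm, on polynomials with
  spectrum in \<open>J\<close>. Quantifying over upper bounds \<open>M\<close> avoids
  suprema.\<close>

definition bounded_multiplier :: "int set \<Rightarrow> (int \<Rightarrow> real) \<Rightarrow> real \<Rightarrow> bool" where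
  "bounded_multiplier J m B \<longleftrightarrow> (\<forall>c M. (\<forall>x. norm (trig_poly J c x) \<le> M) \<longrightarrow>
     (\<forall>x. norm (trig_poly J (\<lambda>j. of_real (m j) * c j) x) \<le> B * M))"

lemma bounded_multiplierI:
  assumes "\<And>c M x. (\<And>y. norm (trig_poly J c y) \<le> M) \<Longrightarrow>
    norm (trig_poly J (\<lambda>j. of_real (m j) * c j) x) \<le> B * M"
  shows "bounded_multiplier J m B"
  using assms unfolding bounded_multiplier_def by blast

lemma bounded_multiplierD:
  assumes "bounded_multiplier J m B" "\<And>y. norm (trig_poly J c y) \<le> M"
  shows "norm (trig_poly J (\<lambda>j. of_real (m j) * c j) x) \<le> B * M"
  using assms unfolding bounded_multiplier_def by blast

lemma bounded_multiplier_cong: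
  assumes "\<And>j. j \<in> J \<Longrightarrow> m j = m' j"
  shows "bounded_multiplier J m B \<longleftrightarrow> bounded_multiplier J m' B"
proof -
  have "trig_poly J (\<lambda>j. of_real (m j) * c j) = trig_poly J (\<lambda>j. of_real (m' j) * c j)" for c
    unfolding trig_poly_def using assms by (intro ext sum.cong) auto
  then show ?thesis unfolding bounded_multiplier_def by simp
qed

lemma bounded_multiplier_const: "bounded_multiplier J (\<lambda>_. r) \<bar>r\<bar>"
proof (rule bounded_multiplierI)
  fix c M x
  assume M: "\<And>y. norm (trig_poly J c y) \<le> M"
  have "trig_poly J (\<lambda>j. of_real r * c j) x = of_real r * trig_poly J c x"
    unfolding trig_poly_def by (simp add: sum_distrib_left mult.assoc)
  then show "norm (trig_poly J (\<lambda>j. of_real r * c j) x) \<le> \<bar>r\<bar> * M"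
    using M[of x] by (simp add: norm_mult mult_left_mono)
qed

lemma bounded_multiplier_add:
  assumes "bounded_multiplier J m B" "bounded_multiplier J m' B'"
  shows "bounded_multiplier J (\<lambda>j. m j + m' j) (B + B')"
proof (rule bounded_multiplierI)
  fix c M x
  assume M: "\<And>y. norm (trig_poly J c y) \<le> M"
  have "trig_poly J (\<lambda>j. of_real (m j + m' j) * c j) x =
      trig_poly J (\<lambda>j. of_real (m j) * c j) x + trig_poly J (\<lambda>j. of_real (m' j) * c j) x"
    unfolding trig_poly_def by (simp add: sum.distrib ring_distribs)
  then show "norm (trig_poly J (\<lambda>j. of_real (m j + m' j) * c j) x) \<le> (B + B') * M"
    using bounded_multiplierD[OF assms(1) M, of x] bounded_multiplierD[OF assms(2) M, of x]
    by (simp add: distrib_right norm_triangle_le)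
qed

lemma bounded_multiplier_mult:
  assumes "bounded_multiplier J m B" "bounded_multiplier J m' B'"
  shows "bounded_multiplier J (\<lambda>j. m j * m' j) (B * B')"
proof (rule bounded_multiplierI)
  fix c M x
  assume M: "\<And>y. norm (trig_poly J c y) \<le> M"
  from bounded_multiplierD[OF assms(1) bounded_multiplierD[OF assms(2) M], of x]
  show "norm (trig_poly J (\<lambda>j. of_real (m j * m' j) * c j) x) \<le> B * B' * M"
    by (simp add: mult.assoc)
qed

lemma bounded_multiplier_sum:
  assumes "\<And>i. i \<in> I \<Longrightarrow> bounded_multiplier J (m i) (B i)"
  shows "bounded_multiplier J (\<lambda>j. \<Sum>i\<in>I. m i j) (\<Sum>i\<in>I. B i)"
  using assms
  by (induction I rule: infinite_finite_induct)
    (use bounded_multiplier_const[of J 0] in \<open>auto intro: bounded_multiplier_add\<close>)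

lemma bounded_multiplier_scale:
  assumes "bounded_multiplier J m B"
  shows "bounded_multiplier J (\<lambda>j. r * m j) (\<bar>r\<bar> * B)"
  by (rule bounded_multiplier_mult[OF bounded_multiplier_const assms])

text \<open>This multiplier is the average of the translations by \<open>s\<close> and by
  \<open>- s\<close>, each of which preserves the sup norm.\<close>

lemma bounded_multiplier_cos: "bounded_multiplier J (\<lambda>j. cos (of_int j * s)) 1"
proof (rule bounded_multiplierI)
  fix c M x
  assume M: "\<And>y. norm (trig_poly J c y) \<le> M"
  have *: "complex_of_real (cos (of_int j * s)) * cis (of_int j * x) =
      (cis (of_int j * (x + s)) + cis (of_int j * (x - s))) / 2" for j
  proof -
    have "complex_of_real (cos (of_int j * s)) = (cis (of_int j * s) + cis (- (of_int j * s))) / 2"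
      by (simp add: complex_eq_iff)
    then show ?thesis
      by (simp add: ring_distribs cis_mult add_divide_distrib algebra_simps)
  qed
  have "trig_poly J (\<lambda>j. of_real (cos (of_int j * s)) * c j) x =
      (\<Sum>j\<in>J. c j * (of_real (cos (of_int j * s)) * cis (of_int j * x)))"
    unfolding trig_poly_def by (simp add: mult_ac)
  also have "\<dots> = (trig_poly J c (x + s) + trig_poly J c (x - s)) / 2"
    unfolding * trig_poly_def
    by (simp add: ring_distribs sum.distrib sum_divide_distrib add_divide_distrib)
  also have "norm \<dots> \<le> M"
    using norm_triangle_ineq[of "trig_poly J c (x + s)" "trig_poly J c (x - s)"] M[of "x + s"] M[of "x - s"]
    by (simp add: norm_divide)
  finally show "norm (trig_poly J (\<lambda>j. of_real (cos (of_int j * s)) * c j) x) \<le> 1 * M" by simp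
qed

section \<open>Fejer multipliers\<close>

lemma card_shifted_pairs:
  "card {a \<in> {0..<int m}. a + j \<in> {0..<int m}} = m - nat \<bar>j\<bar>"
proof -
  have "{a \<in> {0..<int m}. a + j \<in> {0..<int m}} = {max 0 (-j)..<min (int m) (int m - j)}"
    by auto
  then have "card {a \<in> {0..<int m}. a + j \<in> {0..<int m}} = nat (min (int m) (int m - j) - max 0 (-j))"
    by (simp only: card_atLeastLessThan_int)
  also have "\<dots> = m - nat \<bar>j\<bar>" by linarith
  finally show ?thesis .
qed

text \<open>The squared modulus of the Dirichlet-type sum \<open>D\<close> is \<open>m\<close> times
  the Fejer kernel. After expansion into pairs, only those with \<open>b = a + j\<close> survive
  integration; truncated subtraction gives \<open>0\<close> once
  \<open>\<bar>j\<bar> \<ge> m\<close>.\<close>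

lemma fejer_kernel_has_integral:
  fixes m :: nat
  defines "D \<equiv> \<lambda>t. \<Sum>a\<in>{0..<int m}. cis (of_int a * t)"
  shows "((\<lambda>t. (norm (D t))\<^sup>2 *\<^sub>R cis (of_int j * t)) has_integral
     2 * of_real pi * of_nat (m - nat \<bar>j\<bar>)) {-pi..pi}"
proof -
  let ?I = "{0..<int m}"
  have "(norm (D t))\<^sup>2 *\<^sub>R cis (of_int j * t) =
      (\<Sum>a\<in>?I. \<Sum>b\<in>?I. cis (of_int (a - b + j) * t))" for t
  proof -
    have "complex_of_real ((norm (D t))\<^sup>2) = D t * cnj (D t)"
      by (rule complex_norm_square)
    also have "\<dots> = (\<Sum>a\<in>?I. \<Sum>b\<in>?I. cis (of_int a * t) * cis (- (of_int b * t)))"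
      unfolding D_def cnj_sum sum_product cis_cnj ..
    finally show ?thesis
      by (simp only: scaleR_conv_of_real sum_distrib_right cis_mult) (simp add: algebra_simps)
  qed
  moreover have "((\<lambda>t. \<Sum>a\<in>?I. \<Sum>b\<in>?I. cis (of_int (a - b + j) * t)) has_integral
      (\<Sum>a\<in>?I. \<Sum>b\<in>?I. if a - b + j = 0 then 2 * of_real pi else 0)) {-pi..pi}"
    by (intro has_integral_sum has_integral_cis_int) auto
  moreover have "(\<Sum>a\<in>?I. \<Sum>b\<in>?I. if a - b + j = 0 then 2 * complex_of_real pi else 0) =
      2 * of_real pi * of_nat (m - nat \<bar>j\<bar>)"
  proof -
    have "(\<Sum>b\<in>?I. if a - b + j = 0 then 2 * complex_of_real pi else 0) =
        (if a + j \<in> ?I then 2 * of_real pi else 0)" for a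
    proof -
      have "(a - b + j = 0) = (b = a + j)" for b by auto
      then show ?thesis by simp
    qed
    then have "(\<Sum>a\<in>?I. \<Sum>b\<in>?I. if a - b + j = 0 then 2 * complex_of_real pi else 0) =
        (\<Sum>a\<in>{a\<in>?I. a + j \<in> ?I}. 2 * of_real pi)"
      by (simp only: sum.inter_filter finite_atLeastLessThan_int)
    then show ?thesis by (simp add: card_shifted_pairs del: atLeastLessThan_iff)
  qed
  ultimately show ?thesis by simp
qed

text \<open>The multiplier is convolution with a nonnegative kernel, so its norm is at most the mass
  of the kernel, which is the symbol at \<open>0\<close>.\<close>

lemma bounded_multiplier_fejer:
  assumes "finite J"
  shows "bounded_multiplier J (\<lambda>j. real (m - nat \<bar>j\<bar>)) (real m)"
proof (rule bounded_multiplierI)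
  fix c M x
  assume M: "\<And>y. norm (trig_poly J c y) \<le> M"
  define D where "D t = (\<Sum>a\<in>{0..<int m}. cis (of_int a * t))" for t :: real
  note fejer = fejer_kernel_has_integral[of m, folded D_def]
  have "((\<lambda>t. \<Sum>j\<in>J. c j * cis (of_int j * x) * ((norm (D t))\<^sup>2 *\<^sub>R cis (of_int j * t))) has_integral
      (\<Sum>j\<in>J. c j * cis (of_int j * x) * (2 * of_real pi * of_nat (m - nat \<bar>j\<bar>)))) {-pi..pi}"
    by (intro has_integral_sum has_integral_mult_right fejer assms)
  also have "(\<lambda>t. \<Sum>j\<in>J. c j * cis (of_int j * x) * ((norm (D t))\<^sup>2 *\<^sub>R cis (of_int j * t))) =
      (\<lambda>t. (norm (D t))\<^sup>2 *\<^sub>R trig_poly J c (x + t))"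
    unfolding trig_poly_def
    by (simp add: scaleR_conv_of_real sum_distrib_left ring_distribs mult_ac flip: cis_mult)
  also have "(\<Sum>j\<in>J. c j * cis (of_int j * x) * (2 * of_real pi * of_nat (m - nat \<bar>j\<bar>))) =
      2 * of_real pi * trig_poly J (\<lambda>j. of_real (real (m - nat \<bar>j\<bar>)) * c j) x"
    unfolding trig_poly_def by (simp add: sum_distrib_left mult_ac)
  finally have conv: "((\<lambda>t. (norm (D t))\<^sup>2 *\<^sub>R trig_poly J c (x + t)) has_integral
      2 * of_real pi * trig_poly J (\<lambda>j. of_real (real (m - nat \<bar>j\<bar>)) * c j) x) {-pi..pi}" .
  have "((\<lambda>t. (norm (D t))\<^sup>2) has_integral 2 * pi * m) {-pi..pi}"
    using has_integral_Re[OF fejer[of 0]] by simp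
  then have mass: "((\<lambda>t. M * (norm (D t))\<^sup>2) has_integral M * (2 * pi * m)) {-pi..pi}"
    by (rule has_integral_mult_right)
  have "norm ((norm (D t))\<^sup>2 *\<^sub>R trig_poly J c (x + t)) \<le> M * (norm (D t))\<^sup>2" for t
    using mult_left_mono[OF M[of "x + t"], of "(norm (D t))\<^sup>2"] by (simp add: mult.commute)
  from integral_norm_bound_integral[OF has_integral_integrable[OF conv] has_integral_integrable[OF mass] this]
  have "norm (2 * of_real pi * trig_poly J (\<lambda>j. of_real (real (m - nat \<bar>j\<bar>)) * c j) x)
      \<le> M * (2 * pi * m)"
    by (simp only: integral_unique[OF conv] integral_unique[OF mass])
  then show "norm (trig_poly J (\<lambda>j. of_real (real (m - nat \<bar>j\<bar>)) * c j) x) \<le> real m * M"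
    by (simp add: norm_mult mult_ac)
qed

section \<open>Even convex sequences as multipliers\<close>

text \<open>Summation by parts done twice. The truncated differences \<open>m - j\<close> are Fejer
  symbols, so this writes \<open>c\<close> on a finite range as a constant plus a combination of
  them.\<close>

lemma second_difference_summation:
  fixes c :: "nat \<Rightarrow> real"
  assumes "j \<le> Suc M"
  shows "c j = c (Suc M) + (c M - c (Suc M)) * real (Suc M - j)
    + (\<Sum>m=1..M. (c (Suc m) - 2 * c m + c (m - 1)) * real (m - j))"
  using assms
proof (induction M)
  case 0
  then have "j = 0 \<or> j = 1" by auto
  then show ?case by auto
next
  case (Suc M)
  show ?case
  proof (cases "j \<le> Suc M")
    case True
    with Suc.IH show ?thesis by (simp add: of_nat_diff algebra_simps)
  next
    case False
    with Suc.prems have "j = Suc (Suc M)" by simp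
    moreover from this have "real (m - j) = 0" if "m \<in> {1..Suc M}" for m using that by simp
    ultimately show ?thesis by (simp del: of_nat_diff)
  qed
qed

lemma bounded_multiplier_convex:
  fixes c :: "nat \<Rightarrow> real"
  assumes "finite J"
    and nonneg: "\<And>m. c m \<ge> 0" and decr: "\<And>m. c (Suc m) \<le> c m"
    and convex: "\<And>m. m \<ge> 1 \<Longrightarrow> c (Suc m) - 2 * c m + c (m - 1) \<ge> 0"
  shows "bounded_multiplier J (\<lambda>j. c (nat \<bar>j\<bar>)) (c 0)"
proof -
  obtain M where M: "\<And>j. j \<in> J \<Longrightarrow> nat \<bar>j\<bar> \<le> M"
    using finite_imageI[OF assms(1), of "\<lambda>j. nat \<bar>j\<bar>"] unfolding finite_nat_set_iff_bounded_le by blast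
  let ?d = "\<lambda>m. c (Suc m) - 2 * c m + c (m - 1)"
  have "bounded_multiplier J (\<lambda>j. c (Suc M) + (c M - c (Suc M)) * real (Suc M - nat \<bar>j\<bar>)
      + (\<Sum>m=1..M. ?d m * real (m - nat \<bar>j\<bar>)))
     (\<bar>c (Suc M)\<bar> + \<bar>c M - c (Suc M)\<bar> * real (Suc M) + (\<Sum>m=1..M. \<bar>?d m\<bar> * real m))"
    by (intro bounded_multiplier_add bounded_multiplier_const bounded_multiplier_scale
        bounded_multiplier_sum bounded_multiplier_fejer assms(1))
  \<comment> \<open>Convexity makes the weights nonnegative, so the absolute values go; the total of
    the bounds is then the same expansion evaluated at \<open>j = 0\<close>, namely
    \<open>c 0\<close>.\<close>
  also have "(\<Sum>m=1..M. \<bar>?d m\<bar> * real m) = (\<Sum>m=1..M. ?d m * real m)"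
    by (rule sum.cong) (use convex in auto)
  also have "\<bar>c (Suc M)\<bar> + \<bar>c M - c (Suc M)\<bar> * real (Suc M) + (\<Sum>m=1..M. ?d m * real m) = c 0"
    using second_difference_summation[of 0 M c] nonneg[of "Suc M"] decr[of M] by simp
  finally show ?thesis
    by (rule bounded_multiplier_cong[THEN iffD2, rotated])
      (rule second_difference_summation, use M in \<open>auto intro: le_SucI\<close>)
qed

text \<open>The left side is the tangent line of the convex function \<open>1/y^2\<close> at
  \<open>x\<close>, taken at \<open>y\<close>.\<close>

lemma inverse_square_tangent:
  fixes x y :: real
  assumes "x > 0" "y > 0"
  shows "(3 * x - 2 * y) / x ^ 3 \<le> 1 / y\<^sup>2"
proof -
  have "0 \<le> (x - y)\<^sup>2 * (x + 2 * y)" using assms by simp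
  also have "\<dots> = x ^ 3 - (3 * x - 2 * y) * y\<^sup>2"
    by (simp add: power2_eq_square power3_eq_cube algebra_simps)
  finally show ?thesis using assms by (simp add: divide_simps)
qed

text \<open>Below \<open>N\<close> the sequence \<open>1/j\<^sup>2\<close> is continued by its tangent line at \<open>N\<close>, which keeps it convex and
  meets the axis \<open>j = 0\<close> at height \<open>3/N\<^sup>2\<close>.\<close>

lemma bounded_multiplier_inverse_square:
  assumes "finite J" "N \<ge> 1" "\<And>j. j \<in> J \<Longrightarrow> \<bar>j\<bar> \<ge> int N"
  shows "bounded_multiplier J (\<lambda>j. 1 / (of_int j)\<^sup>2) (3 / (real N)\<^sup>2)"
proof -
  define c where "c m = (if m < N then (3 * real N - 2 * real m) / real N ^ 3 else 1 / (real m)\<^sup>2)" for m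
  have N: "real N > 0" using assms(2) by simp
  have c_N: "c m = (3 * real N - 2 * real m) / real N ^ 3" if "m \<le> N" for m
    using that N by (cases "m = N") (auto simp: c_def field_simps power2_eq_square power3_eq_cube)
  \<comment> \<open>For \<open>m > N\<close> the tangent at \<open>m\<close> is compared only with
    points \<open>l \<ge> N\<close>; the tangent at \<open>N\<close> itself is also met by the
    linear piece, with equality.\<close>
  have tangent: "(3 * real m - 2 * real l) / real m ^ 3 \<le> c l" if "m \<ge> N" "l \<ge> N \<or> m = N" for m l
  proof (cases "l < N")
    case True
    then show ?thesis using that c_N[of l] by auto
  next
    case False
    then show ?thesis using inverse_square_tangent[of "real m" "real l"] that N by (simp add: c_def)
  qed
  have conv: "c (Suc m) - 2 * c m + c (m - 1) \<ge> 0" if m: "m \<ge> 1" for m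
  proof (cases "m < N")
    case True
    \<comment> \<open>All three indices lie on the linear piece; \<open>c_N\<close> includes the
      endpoint, which covers \<open>Suc m = N\<close>.\<close>
    then have "c (Suc m) - 2 * c m + c (m - 1) = 0"
      using m by (simp add: c_N of_nat_diff diff_divide_distrib[symmetric] add_divide_distrib[symmetric])
    then show ?thesis by simp
  next
    case False
    \<comment> \<open>The tangent at \<open>m\<close>, evaluated at \<open>m + 1\<close> and
      \<open>m - 1\<close>, averages to \<open>c m\<close>. The index \<open>m - 1\<close> falls
      below \<open>N\<close> only when \<open>m = N\<close>.\<close>
    have "(3 * real m - 2 * real (Suc m)) / real m ^ 3 + (3 * real m - 2 * real (m - 1)) / real m ^ 3
      \<le> c (Suc m) + c (m - 1)"
      using False m by (intro add_mono tangent) auto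
    also have "(3 * real m - 2 * real (Suc m)) / real m ^ 3 + (3 * real m - 2 * real (m - 1)) / real m ^ 3
      = 2 * c m"
      using False m by (simp add: c_def field_simps power2_eq_square power3_eq_cube)
    finally show ?thesis by simp
  qed
  have decr: "c (Suc m) \<le> c m" for m
  proof (cases "m < N")
    case True
    then show ?thesis using N by (simp add: c_N divide_right_mono)
  next
    case False
    then show ?thesis using N by (auto simp: c_def intro!: divide_left_mono power_mono mult_pos_pos)
  qed
  have "bounded_multiplier J (\<lambda>j. c (nat \<bar>j\<bar>)) (c 0)"
    by (intro bounded_multiplier_convex conv decr assms(1)) (auto simp: c_def)
  also have "c 0 = 3 / (real N)\<^sup>2"
    using N by (simp add: c_N power2_eq_square power3_eq_cube)
  finally show ?thesis
  proof (rule bounded_multiplier_cong[THEN iffD2, rotated])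
    fix j assume "j \<in> J"
    then have "\<not> nat \<bar>j\<bar> < N" using assms(3)[of j] by linarith
    then show "1 / (real_of_int j)\<^sup>2 = c (nat \<bar>j\<bar>)" by (simp add: c_def)
  qed
qed

section \<open>Averaged differences\<close>

text \<open>The cosine transform of the hat weight, folded onto \<open>t \<ge> 0\<close>. The value
  at \<open>l = 0\<close> is the limit of the general formula and needs its own case because
  division by zero yields \<open>0\<close>.\<close>

lemma hat_integral:
  fixes h l :: real
  assumes "h \<ge> 0"
  shows "((\<lambda>t. (h - t) * (2 * cos (l * t))) has_integral
    (if l = 0 then h\<^sup>2 else 2 * (1 - cos (l * h)) / l\<^sup>2)) {0..h}"
proof (cases "l = 0")
  case True
  have "((\<lambda>t. (h - t) * 2) has_integral (2 * h * h - h\<^sup>2) - (2 * h * 0 - 0\<^sup>2)) {0..h}"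
    by (intro fundamental_theorem_of_calculus assms)
      (auto intro!: derivative_eq_intros simp: has_real_derivative_iff_has_vector_derivative[symmetric])
  then show ?thesis using True by (simp add: power2_eq_square)
next
  case False
  define F where "F t = 2 * ((h - t) * sin (l * t) / l - cos (l * t) / l\<^sup>2)" for t
  have "(F has_real_derivative (h - t) * (2 * cos (l * t))) (at t within {0..h})" for t
    unfolding F_def using False
    by (auto intro!: derivative_eq_intros simp: field_simps power2_eq_square)
  then have "((\<lambda>t. (h - t) * (2 * cos (l * t))) has_integral (F h - F 0)) {0..h}"
    by (intro fundamental_theorem_of_calculus assms)
      (auto simp: has_real_derivative_iff_has_vector_derivative)
  moreover have "F h - F 0 = 2 * (1 - cos (l * h)) / l\<^sup>2"
    unfolding F_def by (simp add: diff_divide_distrib right_diff_distrib)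
  ultimately show ?thesis using False by simp
qed

text \<open>Pairing \<open>t\<close> with \<open>- t\<close> turns the exponentials into cosines,
  and the even order \<open>2 * k\<close> replaces the sign \<open>(-1) ^ (2 * k - i)\<close> by
  \<open>(-1) ^ i\<close>.\<close>

lemma central_diff_trig_poly_symmetric:
  "central_diff (2 * k) t (trig_poly J c) x + central_diff (2 * k) (- t) (trig_poly J c) x =
    (\<Sum>j\<in>J. c j * cis (of_int j * x) * of_real (\<Sum>i=0..2 * k. (-1) ^ i * real (2 * k choose i)
       * (2 * cos (of_int j * (real i - real k) * t))))"
proof -
  have shift: "central_diff (2 * k) t (trig_poly J c) x =
      (\<Sum>i=0..2 * k. \<Sum>j\<in>J. (-1) ^ i * of_nat (2 * k choose i) * c j * cis (of_int j * x)
         * cis (of_int j * (real i - real k) * t))" for t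
    unfolding central_diff_def trig_poly_def
  proof (intro sum.cong refl)
    fix i assume "i \<in> {0..2 * k}"
    then have "(-1 :: complex) ^ (2 * k - i) = (-1) ^ i"
      by (simp add: uminus_power_if)
    moreover have "cis (of_int j * (x - real (2 * k) / 2 * t + real i * t)) =
        cis (of_int j * x) * cis (of_int j * (real i - real k) * t)" for j
      by (simp add: cis_mult algebra_simps)
    ultimately show "(- 1) ^ (2 * k - i) * of_nat (2 * k choose i) *
        (\<Sum>j\<in>J. c j * cis (of_int j * (x - real (2 * k) / 2 * t + real i * t))) =
       (\<Sum>j\<in>J. (- 1) ^ i * of_nat (2 * k choose i) * c j * cis (of_int j * x) *
          cis (of_int j * (real i - real k) * t))"
      by (simp add: sum_distrib_left mult.assoc)
  qed
  have "complex_of_real (2 * cos y) = cis y + cis (- y)" for y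
    by (simp add: complex_eq_iff)
  then have "central_diff (2 * k) t (trig_poly J c) x + central_diff (2 * k) (- t) (trig_poly J c) x =
      (\<Sum>i=0..2 * k. \<Sum>j\<in>J. (-1) ^ i * of_nat (2 * k choose i) * c j * cis (of_int j * x)
         * of_real (2 * cos (of_int j * (real i - real k) * t)))"
    unfolding shift by (simp add: sum.distrib[symmetric] ring_distribs)
  also have "\<dots> = (\<Sum>j\<in>J. \<Sum>i=0..2 * k. (-1) ^ i * of_nat (2 * k choose i) * c j * cis (of_int j * x)
         * of_real (2 * cos (of_int j * (real i - real k) * t)))"
    by (rule sum.swap)
  also have "\<dots> = (\<Sum>j\<in>J. c j * cis (of_int j * x) * of_real (\<Sum>i=0..2 * k. (-1) ^ i * real (2 * k choose i)
       * (2 * cos (of_int j * (real i - real k) * t))))"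
    by (intro sum.cong refl) (simp add: sum_distrib_left mult_ac)
  finally show ?thesis .
qed

text \<open>The error symbol of the averaged difference. It has no factor \<open>1/h^2\<close>,
  since the weight \<open>h - t\<close> is used unnormalised.\<close>

definition off_center_multiplier :: "nat \<Rightarrow> real \<Rightarrow> int \<Rightarrow> real" where
  "off_center_multiplier k h j = 1 / (of_int j)\<^sup>2 * (\<Sum>i\<in>{0..2 * k} - {k}.
     (-1) ^ i * real (2 * k choose i) * (2 / (real i - real k)\<^sup>2)
       * (1 - cos (of_int j * ((real i - real k) * h))))"

text \<open>The term \<open>i = k\<close> does not depend on \<open>t\<close> and picks up the full
  mass \<open>h^2\<close> of the weight; the others have nonzero frequency \<open>j (i - k)\<close>,
  because \<open>0\<close> is not in \<open>J\<close>.\<close>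

lemma central_diff_average:
  fixes h :: real
  assumes "finite J" "0 \<notin> J" "h \<ge> 0"
  shows "((\<lambda>t. (h - t) *\<^sub>R (central_diff (2 * k) t (trig_poly J c) x + central_diff (2 * k) (- t) (trig_poly J c) x))
    has_integral
     (of_real ((-1) ^ k * real (2 * k choose k) * h\<^sup>2) * trig_poly J c x
      + trig_poly J (\<lambda>j. of_real (off_center_multiplier k h j) * c j) x)) {0..h}"
proof -
  let ?H = "\<lambda>l. if l = 0 then h\<^sup>2 else 2 * (1 - cos (l * h)) / l\<^sup>2"
  have "((\<lambda>t. \<Sum>j\<in>J. c j * cis (of_int j * x) * of_real (\<Sum>i=0..2 * k. (-1) ^ i * real (2 * k choose i)
       * ((h - t) * (2 * cos (of_int j * (real i - real k) * t))))) has_integral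
     (\<Sum>j\<in>J. c j * cis (of_int j * x) * of_real (\<Sum>i=0..2 * k. (-1) ^ i * real (2 * k choose i)
       * ?H (of_int j * (real i - real k))))) {0..h}"
    by (intro has_integral_sum has_integral_mult_right has_integral_of_real hat_integral assms) auto
  also have "(\<lambda>t. \<Sum>j\<in>J. c j * cis (of_int j * x) * of_real (\<Sum>i=0..2 * k. (-1) ^ i * real (2 * k choose i)
       * ((h - t) * (2 * cos (of_int j * (real i - real k) * t))))) =
     (\<lambda>t. (h - t) *\<^sub>R (central_diff (2 * k) t (trig_poly J c) x + central_diff (2 * k) (- t) (trig_poly J c) x))"
    unfolding central_diff_trig_poly_symmetric
    by (simp add: scaleR_conv_of_real sum_distrib_left mult_ac)
  also have "(\<Sum>j\<in>J. c j * cis (of_int j * x) * of_real (\<Sum>i=0..2 * k. (-1) ^ i * real (2 * k choose i)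
       * ?H (of_int j * (real i - real k)))) =
     (\<Sum>j\<in>J. c j * cis (of_int j * x) * of_real ((-1) ^ k * real (2 * k choose k) * h\<^sup>2 + off_center_multiplier k h j))"
  proof (intro sum.cong refl arg_cong2[where f = "(*)"] arg_cong[where f = of_real])
    fix j assume "j \<in> J"
    with assms(2) have j: "j \<noteq> 0" by auto
    have "(\<Sum>i=0..2 * k. (-1) ^ i * real (2 * k choose i) * ?H (of_int j * (real i - real k))) =
        (-1) ^ k * real (2 * k choose k) * h\<^sup>2
        + (\<Sum>i\<in>{0..2 * k} - {k}. (-1) ^ i * real (2 * k choose i) * ?H (of_int j * (real i - real k)))"
      by (subst sum.remove[of _ k]) auto
    also have "(\<Sum>i\<in>{0..2 * k} - {k}. (-1) ^ i * real (2 * k choose i) * ?H (of_int j * (real i - real k)))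
        = off_center_multiplier k h j"
      unfolding off_center_multiplier_def sum_distrib_left
      by (intro sum.cong refl) (use j in \<open>auto simp: power_mult_distrib mult_ac\<close>)
    finally show "(\<Sum>i=0..2 * k. (-1) ^ i * real (2 * k choose i) * ?H (of_int j * (real i - real k))) =
        (-1) ^ k * real (2 * k choose k) * h\<^sup>2 + off_center_multiplier k h j" .
  qed
  also have "\<dots> = of_real ((-1) ^ k * real (2 * k choose k) * h\<^sup>2) * trig_poly J c x
      + trig_poly J (\<lambda>j. of_real (off_center_multiplier k h j) * c j) x"
    unfolding trig_poly_def of_real_add ring_distribs sum.distrib sum_distrib_left
    by (simp only: mult_ac)
  finally show ?thesis .
qed

section \<open>Size of the off-center terms\<close>

lemma alternating_inverse_squares_sum_le:
  fixes s :: real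
  assumes "\<bar>s\<bar> = 1"
  shows "(\<Sum>d=1..k. (1 + s * (-1) ^ d) / (real d)\<^sup>2) \<le> 5 / 2"
proof (cases "k = 0")
  case False
  then have "k \<ge> 1" by simp
  \<comment> \<open>The bound is strengthened by a telescoping tail so that induction works. Only
    one parity of \<open>d\<close> contributes, each time \<open>2/d^2\<close>; the case split
    records whether the last index did. The constant is \<open>2 + 1/2\<close>, attained at
    \<open>k = 1\<close> when \<open>d = 1\<close> contributes.\<close>
  then have "(\<Sum>d=1..k. (1 + s * (-1) ^ d) / (real d)\<^sup>2) \<le>
      5 / 2 - (if s * (-1) ^ k = 1 then 1 / (real k + 1) else 1 / real k)"
  proof (induction k rule: dec_induct)
    case base
    then show ?case using assms by (auto simp: abs_if split: if_splits)
  next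
    case (step m)
    have m: "real m \<ge> 1" using step(1) by simp
    have "2 / (real m + 1)\<^sup>2 \<le> 1 / real m - 1 / (real m + 2)"
      using m by (simp add: divide_simps power2_eq_square) (simp add: algebra_simps)
    moreover have "s * (-1) ^ m = 1 \<or> s * (-1) ^ m = -1"
      using assms by (cases "even m") (auto simp: abs_if split: if_splits)
    ultimately show ?case using step(3) by (auto simp: add_ac)
  qed
  also have "\<dots> \<le> 5 / 2" by simp
  finally show ?thesis .
qed simp

lemma symmetric_sum:
  fixes g :: "real \<Rightarrow> real"
  assumes "\<And>y. g (- y) = g y"
  shows "(\<Sum>i\<in>{0..2 * k} - {k}. g (real i - real k)) = 2 * (\<Sum>d=1..k. g (real d))"
proof -
  have "{0..2 * k} - {k} = {0..<k} \<union> {k + 1..2 * k}" by auto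
  moreover have "{0..<k} \<inter> {k + 1..2 * k} = {}" by auto
  ultimately have "(\<Sum>i\<in>{0..2 * k} - {k}. g (real i - real k)) =
      (\<Sum>i\<in>{0..<k}. g (real i - real k)) + (\<Sum>i\<in>{k + 1..2 * k}. g (real i - real k))"
    by (metis finite_atLeastAtMost finite_atLeastLessThan sum.union_disjoint)
  also have "(\<Sum>i\<in>{0..<k}. g (real i - real k)) = (\<Sum>i\<in>{0..<k}. g (real (k - i)))"
  proof (rule sum.cong[OF refl])
    fix i assume "i \<in> {0..<k}"
    then have "real i - real k = - real (k - i)" by (simp add: of_nat_diff)
    then show "g (real i - real k) = g (real (k - i))" by (simp only: assms)
  qed
  also have "\<dots> = (\<Sum>d=1..k. g (real d))"
    by (rule sum.reindex_bij_witness[of _ "\<lambda>d. k - d" "\<lambda>i. k - i"]) auto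
  also have "(\<Sum>i\<in>{k + 1..2 * k}. g (real i - real k)) = (\<Sum>d=1..k. g (real d))"
    by (rule sum.reindex_bij_witness[of _ "\<lambda>d. d + k" "\<lambda>i. i - k"]) (auto simp: of_nat_diff)
  finally show ?thesis by simp
qed

lemma off_center_binomial_le:
  assumes "i \<noteq> k"
  shows "2 * k choose i \<le> 2 * k choose (k + 1)"
proof -
  have *: "2 * k choose i \<le> 2 * k choose (k + 1)" if "i \<ge> k + 1" for i
    using that by (cases "i \<le> 2 * k") (auto intro: binomial_antimono simp: binomial_eq_0)
  show ?thesis
  proof (cases "i \<ge> k + 1")
    case False
    with assms have "i < k" by simp
    then show ?thesis using *[of "2 * k - i"] binomial_symmetric[of i "2 * k"] by simp
  qed (rule *)
qed

text \<open>The factors \<open>1 + s * (-1) ^ i\<close> are nonnegative, so each binomial may be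
  replaced by the largest off-center one; what is left depends only on the distance from
  \<open>i\<close> to \<open>k\<close>.\<close>

lemma off_center_sum_le:
  fixes s :: real
  assumes "\<bar>s\<bar> = 1"
  shows "(\<Sum>i\<in>{0..2 * k} - {k}. (1 + s * (-1) ^ i) * (real (2 * k choose i) / (real i - real k)\<^sup>2))
    \<le> 5 * real (2 * k choose (k + 1))"
proof -
  let ?C = "real (2 * k choose (k + 1))"
  have sgn: "0 \<le> 1 + s * (-1) ^ i" for i
    using assms by (cases "even i") (auto simp: abs_if split: if_splits)
  have "(\<Sum>i\<in>{0..2 * k} - {k}. (1 + s * (-1) ^ i) * (real (2 * k choose i) / (real i - real k)\<^sup>2))
      \<le> (\<Sum>i\<in>{0..2 * k} - {k}. ?C * ((1 + s * (-1) ^ k * (-1) ^ nat \<bar>int i - int k\<bar>) / (real i - real k)\<^sup>2))"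
  proof (rule sum_mono)
    fix i assume i: "i \<in> {0..2 * k} - {k}"
    have "even (nat \<bar>int i - int k\<bar>) \<longleftrightarrow> even (i + k)"
      by (simp add: even_nat_iff)
    then have "(-1 :: real) ^ k * (-1) ^ nat \<bar>int i - int k\<bar> = (-1) ^ i"
      by (auto simp: uminus_power_if)
    then have sign: "s * (-1) ^ k * (-1) ^ nat \<bar>int i - int k\<bar> = s * (-1) ^ i" by (simp add: mult.assoc)
    have "(1 + s * (-1) ^ i) * (real (2 * k choose i) / (real i - real k)\<^sup>2)
        \<le> (1 + s * (-1) ^ i) * (?C / (real i - real k)\<^sup>2)"
      using i off_center_binomial_le[of i k] by (intro mult_left_mono divide_right_mono sgn) auto
    then show "(1 + s * (-1) ^ i) * (real (2 * k choose i) / (real i - real k)\<^sup>2)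
        \<le> ?C * ((1 + s * (-1) ^ k * (-1) ^ nat \<bar>int i - int k\<bar>) / (real i - real k)\<^sup>2)"
      unfolding sign by (simp add: mult_ac)
  qed
  also have "\<dots> = ?C * (2 * (\<Sum>d=1..k. (1 + s * (-1) ^ k * (-1) ^ d) / (real d)\<^sup>2))"
  proof -
    \<comment> \<open>\<open>symmetric_sum\<close> takes a function of a real argument, so the
      parity of the distance is expressed through a floor.\<close>
    have "nat \<lfloor>\<bar>real i - real k\<bar>\<rfloor> = nat \<bar>int i - int k\<bar>" for i
      by (metis floor_of_int of_int_abs of_int_diff of_int_of_nat_eq)
    then show ?thesis
      unfolding sum_distrib_left[symmetric] using symmetric_sum[of "\<lambda>y. (1 + s * (-1) ^ k * (-1) ^ nat \<lfloor>\<bar>y\<bar>\<rfloor>) / y\<^sup>2" k]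
      by simp
  qed
  also have "\<dots> \<le> ?C * (2 * (5 / 2))"
    using alternating_inverse_squares_sum_le[of "s * (-1) ^ k" k] assms
    by (intro mult_left_mono) (auto simp: abs_mult power_abs)
  finally show ?thesis by simp
qed

text \<open>The constants in the terms \<open>1 - cos\<close> are collected into
  \<open>2 * A\<close>, which keeps their alternating cancellation: the norm is at most
  \<open>2\<bar>A\<bar> + 2W\<close> times \<open>3/n^2\<close>, instead of \<open>4W\<close> times
  it.\<close>

lemma bounded_multiplier_off_center:
  assumes "finite J" "n \<ge> 1" "\<And>j. j \<in> J \<Longrightarrow> \<bar>j\<bar> \<ge> int n"
  obtains B where "B \<le> 30 / (real n)\<^sup>2 * real (2 * k choose (k + 1))"
    "bounded_multiplier J (off_center_multiplier k h) B"
proof -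
  let ?I = "{0..2 * k} - {k}" and ?C = "real (2 * k choose (k + 1))"
  define w where "w i = real (2 * k choose i) / (real i - real k)\<^sup>2" for i
  define A where "A = (\<Sum>i\<in>?I. (-1) ^ i * w i)"
  define W where "W = (\<Sum>i\<in>?I. w i)"
  have "W + s * A \<le> 5 * ?C" if "\<bar>s\<bar> = 1" for s
    using off_center_sum_le[OF that, of k, folded w_def]
    by (simp add: A_def W_def sum_distrib_left ring_distribs sum.distrib mult.assoc)
  \<comment> \<open>The two signs of \<open>s\<close> bound \<open>W + A\<close> and
    \<open>W - A\<close>, hence \<open>\<bar>A\<bar> + W\<close>.\<close>
  from this[of 1] this[of "-1"] have AW: "\<bar>A\<bar> + W \<le> 5 * ?C" by linarith
  have "bounded_multiplier J (\<lambda>j. 1 / (of_int j)\<^sup>2 *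
      (2 * A + (\<Sum>i\<in>?I. (- 2 * (-1) ^ i * w i) * cos (of_int j * ((real i - real k) * h)))))
      (3 / (real n)\<^sup>2 * (\<bar>2 * A\<bar> + (\<Sum>i\<in>?I. \<bar>- 2 * (-1) ^ i * w i\<bar> * 1)))"
    by (intro bounded_multiplier_mult bounded_multiplier_add bounded_multiplier_const bounded_multiplier_sum
        bounded_multiplier_scale bounded_multiplier_cos bounded_multiplier_inverse_square assms)
  also have "(\<lambda>j. 1 / (of_int j)\<^sup>2 *
      (2 * A + (\<Sum>i\<in>?I. (- 2 * (-1) ^ i * w i) * cos (of_int j * ((real i - real k) * h))))) =
     off_center_multiplier k h"
    unfolding off_center_multiplier_def
  proof (intro ext arg_cong2[where f = "(*)"] refl)
    fix j :: int
    show "2 * A + (\<Sum>i\<in>?I. (- 2 * (-1) ^ i * w i) * cos (of_int j * ((real i - real k) * h))) =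
      (\<Sum>i\<in>?I. (-1) ^ i * real (2 * k choose i) * (2 / (real i - real k)\<^sup>2)
         * (1 - cos (of_int j * ((real i - real k) * h))))"
      unfolding A_def sum_distrib_left sum.distrib[symmetric]
      by (intro sum.cong refl) (simp add: w_def diff_divide_distrib right_diff_distrib mult_ac)
  qed
  also have "(\<Sum>i\<in>?I. \<bar>- 2 * (-1) ^ i * w i\<bar> * 1) = 2 * W"
    by (simp add: W_def w_def sum_distrib_left abs_mult power_abs)
  finally have "bounded_multiplier J (off_center_multiplier k h)
      (3 / (real n)\<^sup>2 * (\<bar>2 * A\<bar> + 2 * W))" .
  moreover have "3 / (real n)\<^sup>2 * (\<bar>2 * A\<bar> + 2 * W) \<le> 3 / (real n)\<^sup>2 * (10 * ?C)"
    using AW by (intro mult_left_mono) auto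
  ultimately show thesis by (intro that) auto
qed

section \<open>The inequality for trigonometric polynomials\<close>

lemma trig_poly_C_T: "trig_poly J c \<in> C_T"
proof -
  have "cis (of_int j * (x + 2 * pi)) = cis (of_int j * x)" for j x
  proof -
    have "cis (of_int j * (x + 2 * pi)) = cis (of_int j * x) * cis (2 * pi * of_int j)"
      by (simp add: cis_mult algebra_simps)
    then show ?thesis by (simp add: cis_multiple_2pi)
  qed
  then show ?thesis
    unfolding C_T_def using continuous_on_trig_poly by (simp add: trig_poly_def)
qed

text \<open>The averaged difference is evaluated at a maximum point \<open>x\<close> of the modulus:
  there the main term has size \<open>?C * h\<^sup>2 * M\<close>, while the error is at most
  \<open>?C1 * h\<^sup>2 * M\<close> and can be absorbed.\<close>

lemma trig_poly_norm_le_central_diff: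
  fixes h :: real
  assumes "finite J" "n \<ge> 1" "\<And>j. j \<in> J \<Longrightarrow> \<bar>j\<bar> \<ge> int n"
    and "h > 0" "30 \<le> (real n * h)\<^sup>2"
    and W: "\<And>t x. \<bar>t\<bar> < h \<Longrightarrow> norm (central_diff (2 * k) t (trig_poly J c) x) \<le> W"
  shows "norm (trig_poly J c y) \<le> (real k + 1) / real (2 * k choose k) * W"
proof -
  let ?p = "trig_poly J c" and ?C = "real (2 * k choose k)" and ?C1 = "real (2 * k choose (k + 1))"
  obtain x where x: "\<And>z. norm (?p z) \<le> norm (?p x)"
    using norm_T_attained[OF trig_poly_C_T] by blast
  define M where "M = norm (?p x)"
  let ?q = "off_center_multiplier k h"
  obtain B where B: "B \<le> 30 / (real n)\<^sup>2 * ?C1" and q: "bounded_multiplier J ?q B"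
    using bounded_multiplier_off_center[OF assms(1-3)] by blast
  have "0 \<notin> J" using assms(2) assms(3)[of 0] by auto
  note avg = central_diff_average[OF assms(1) this less_imp_le[OF assms(4)], of k c x]
  have bound: "norm ((h - t) *\<^sub>R (central_diff (2 * k) t ?p x + central_diff (2 * k) (- t) ?p x))
      \<le> W * ((h - t) * 2)" if "t \<in> {0..h}" for t
  \<comment> \<open>The hypothesis on differences stops short of \<open>t = h\<close>, but the
    weight vanishes there.\<close>
  proof (cases "t = h")
    case False
    with that have t: "\<bar>t\<bar> < h" "\<bar>- t\<bar> < h" by auto
    have "norm (central_diff (2 * k) t ?p x + central_diff (2 * k) (- t) ?p x) \<le> 2 * W"
      using W[OF t(1), of x] W[OF t(2), of x] by norm
    then have "(h - t) * norm (central_diff (2 * k) t ?p x + central_diff (2 * k) (- t) ?p x) \<le> (h - t) * (2 * W)"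
      using that by (intro mult_left_mono) auto
    then show ?thesis using that by (simp add: mult_ac)
  qed simp
  have mass: "((\<lambda>t. W * ((h - t) * 2)) has_integral (W * h\<^sup>2)) {0..h}"
    using hat_integral[of h 0] assms(4) by (intro has_integral_mult_right) simp
  have "norm (of_real ((-1) ^ k * ?C * h\<^sup>2) * ?p x + trig_poly J (\<lambda>j. of_real (?q j) * c j) x) \<le> W * h\<^sup>2"
    using integral_norm_bound_integral[OF has_integral_integrable[OF avg] has_integral_integrable[OF mass] bound]
    by (simp only: integral_unique[OF avg] integral_unique[OF mass])
  moreover have "norm (of_real ((-1) ^ k * ?C * h\<^sup>2) * ?p x) = ?C * h\<^sup>2 * M"
    by (simp add: norm_mult norm_power M_def abs_mult power_abs)
  moreover have "norm (trig_poly J (\<lambda>j. of_real (?q j) * c j) x) \<le> B * M"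
    by (rule bounded_multiplierD[OF q]) (simp add: M_def x)
  ultimately have "?C * h\<^sup>2 * M \<le> W * h\<^sup>2 + B * M"
    by (smt (verit) norm_diff_ineq)
  also have "\<dots> \<le> W * h\<^sup>2 + ?C1 * h\<^sup>2 * M"
  proof -
    have "30 / (real n)\<^sup>2 \<le> h\<^sup>2"
      using assms(2,5) by (simp add: divide_le_eq power_mult_distrib mult.commute)
    then have "30 / (real n)\<^sup>2 * ?C1 \<le> ?C1 * h\<^sup>2"
      by (subst mult.commute) (intro mult_left_mono, auto)
    then show ?thesis using B by (intro add_left_mono mult_right_mono) (auto simp: M_def)
  qed
  finally have "(?C - ?C1) * M * h\<^sup>2 \<le> W * h\<^sup>2" by (simp add: algebra_simps)
  then have le_W: "(?C - ?C1) * M \<le> W" using assms(4) by simp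
  \<comment> \<open>Since \<open>?C1\<close> is \<open>k/(k+1)\<close> times \<open>?C\<close>, the
    gap \<open>?C - ?C1\<close> equals \<open>?C/(k+1)\<close>; this is the source of the factor
    \<open>k + 1\<close>.\<close>
  have "?C = (?C - ?C1) * (real k + 1)"
  proof -
    have "Suc k * (2 * k choose Suc k) = k * (2 * k choose k)"
      using Suc_times_binomial_add[of k "k - 1"] by (cases k) (simp_all add: mult_2 del: binomial_Suc_Suc)
    then have "real (Suc k) * ?C1 = real k * ?C"
      unfolding of_nat_mult[symmetric] by simp
    then show ?thesis by (simp add: algebra_simps)
  qed
  then have "?C * M = (?C - ?C1) * (real k + 1) * M"
    by (rule arg_cong)
  also have "\<dots> = (real k + 1) * ((?C - ?C1) * M)"
    by (simp only: mult_ac)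
  also have "\<dots> \<le> (real k + 1) * W"
    using le_W by (intro mult_left_mono) auto
  finally have "?C * M \<le> (real k + 1) * W" .
  then have "M \<le> (real k + 1) / ?C * W"
    by (simp add: field_simps zero_less_binomial)
  then show ?thesis using x[of y] by (simp add: M_def)
qed

section \<open>Passage from polynomials to continuous functions\<close>

lemma central_diff_C_T:
  assumes "f \<in> C_T"
  shows "central_diff m t f \<in> C_T"
proof -
  have f: "continuous_on UNIV f" "\<And>x. f (x + 2 * pi) = f x" using assms by (auto simp: C_T_def)
  have "f (x + 2 * pi - real m / 2 * t + real i * t) = f (x - real m / 2 * t + real i * t)" for x i
    using f(2)[of "x - real m / 2 * t + real i * t"] by (simp add: algebra_simps)
  then have "central_diff m t f (x + 2 * pi) = central_diff m t f x" for x
    by (simp add: central_diff_def)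
  moreover have "continuous_on UNIV (central_diff m t f)"
    unfolding central_diff_def
    by (intro continuous_intros continuous_on_compose2[OF f(1)]) auto
  ultimately show ?thesis by (simp add: C_T_def)
qed

lemma central_diff_le_modulus_smoothness:
  assumes "f \<in> C_T" "\<bar>t\<bar> < \<delta>"
  shows "norm (central_diff m t f x) \<le> modulus_smoothness m f \<delta>"
proof -
  obtain y where y: "y \<in> {-pi..<pi}" "central_diff m t f y = central_diff m t f x"
    using C_T_reduce[OF central_diff_C_T[OF assms(1)]] .
  have "norm (central_diff m t f y) \<le> modulus_smoothness m f \<delta>"
    unfolding modulus_smoothness_def
    using cSUP_upper[OF _ modulus_smoothness_bdd_above[OF assms(1)], of "(y, t)" \<delta> m] y(1) assms(2)
    by simp
  with y(2) show ?thesis by simp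
qed

lemma central_diff_perturb:
  assumes "\<And>x. norm (f x - g x) \<le> e"
  shows "norm (central_diff m t g x) \<le> norm (central_diff m t f x) + 2 ^ m * e"
proof -
  have "norm (central_diff m t g x - central_diff m t f x) \<le> (\<Sum>i=0..m. real (m choose i) * e)"
    unfolding central_diff_def sum_subtractf[symmetric] right_diff_distrib[symmetric]
    by (intro sum_norm_le) (auto simp: norm_mult norm_power norm_minus_commute intro!: mult_left_mono assms)
  also have "\<dots> = 2 ^ m * e"
    using choose_row_sum[of m] by (simp flip: sum_distrib_right of_nat_sum add: atMost_atLeast0)
  finally show ?thesis
    using norm_triangle_sub[of "central_diff m t g x" "central_diff m t f x"] by linarith
qed

theorem theorem2:
  fixes \<alpha> :: real and k n :: nat and f :: "real \<Rightarrow> complex"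
  defines "\<alpha> \<equiv> 2 powr (-5/2) * 3 powr (1/2) * pi"
  assumes "k \<ge> 1" and "n \<ge> 2 * k" and "f \<in> C_T_perp n"
  shows "norm_T f \<le> (real k + 1) / real ((2 * k) choose k)
           * modulus_smoothness (2 * k) f (2 * pi / real n * \<alpha>)"
proof -
  define h where "h = 2 * pi / real n * \<alpha>"
  define R where "R = (real k + 1) / real (2 * k choose k)"
  have n: "n \<ge> 1" using assms(2,3) by simp
  have f: "f \<in> C_T" using assms(4) by (simp add: C_T_perp_def)
  have "\<alpha> > 0" by (simp add: \<alpha>_def)
  then have h: "h > 0" using n by (simp add: h_def)
  have "(2 powr (-5/2) :: real)\<^sup>2 = 2 powr (- 5)"
    by (simp add: power2_eq_square flip: powr_add)
  also have "\<dots> = 1 / 32" by (simp add: powr_minus_divide)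
  finally have "(2 powr (-5/2) :: real)\<^sup>2 = 1 / 32" .
  moreover have "(3 powr (1/2) :: real)\<^sup>2 = 3"
    by (simp add: power2_eq_square flip: powr_add)
  moreover have "real n * h = 2 * pi\<^sup>2 * 2 powr (-5/2) * 3 powr (1/2)"
    using n by (simp add: h_def \<alpha>_def power2_eq_square)
  ultimately have "(real n * h)\<^sup>2 = 3 / 8 * pi ^ 4"
    by (simp only: power_mult_distrib) (simp flip: power_mult)
  \<comment> \<open>The crude bound suffices: \<open>3/8 * 81 = 30.375\<close>, just above the
    required \<open>30\<close>.\<close>
  moreover have "3 ^ 4 \<le> pi ^ 4" using pi_gt3 by (intro power_mono) auto
  ultimately have nh: "30 \<le> (real n * h)\<^sup>2" by simp
  obtain x where x: "norm_T f = norm (f x)" using norm_T_attained[OF f] by blast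
  have "norm (f x) \<le> R * modulus_smoothness (2 * k) f h + e" if "e > 0" for e
  proof -
    \<comment> \<open>Replacing \<open>f\<close> by the polynomial costs \<open>d\<close> in the
      norm and \<open>2 ^ (2 * k) * d\<close> in the differences; weighted by \<open>R\<close> these
      add up to \<open>e\<close>.\<close>
    define d where "d = e / (1 + R * 2 ^ (2 * k))"
    have R: "R \<ge> 0" by (simp add: R_def)
    then have d: "d > 0" using that by (simp add: d_def add_pos_nonneg)
    obtain J c where J: "finite J" "\<And>j. j \<in> J \<Longrightarrow> \<bar>j\<bar> > int n"
      and close: "\<And>x. norm (f x - trig_poly J c x) < d"
      using C_T_perp_approx[OF assms(4) d] by blast
    have "norm (central_diff (2 * k) t (trig_poly J c) y) \<le> modulus_smoothness (2 * k) f h + 2 ^ (2 * k) * d"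
      if "\<bar>t\<bar> < h" for t y
      using central_diff_perturb[of f "trig_poly J c" d "2 * k" t y] less_imp_le[OF close]
        central_diff_le_modulus_smoothness[OF f that, of "2 * k" y] by fastforce
    from trig_poly_norm_le_central_diff[OF J(1) n less_imp_le[OF J(2)] h nh this]
    have "norm (trig_poly J c x) \<le> R * (modulus_smoothness (2 * k) f h + 2 ^ (2 * k) * d)"
      by (simp add: R_def)
    then have "norm (f x) \<le> R * modulus_smoothness (2 * k) f h + d * (1 + R * 2 ^ (2 * k))"
      using close[of x] norm_triangle_ineq[of "f x - trig_poly J c x" "trig_poly J c x"]
      by (simp add: algebra_simps)
    also have "d * (1 + R * 2 ^ (2 * k)) = e"
      using R by (simp add: d_def add_pos_nonneg less_imp_neq[symmetric])
    finally show ?thesis .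
  qed
  then have "norm (f x) \<le> R * modulus_smoothness (2 * k) f h"
    by (rule field_le_epsilon)
  then show ?thesis by (simp add: x R_def h_def)
qed

end
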